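(* Let $0<a<1$ and let $C_a$ be the Chebyshev's method of $p_a(z)=(z^2-1)(z^2-a)$. All the extraneous fixed points of $C_a$ are in the real interval $(-1,1)$ and hence are repelling.
   Context: For a polynomial $p$, the Chebyshev's method of $p$ is the rational map $C_p(z)=z-\left[1+\frac12 L_p(z)\right]\frac{p(z)}{p'(z)}$ with $L_p(z)=\frac{p(z)p''(z)}{(p'(z))^2}$. For $p_a(z)=(z^2-1)(z^2-a)$ write $C_a:=C_{p_a}$. An extraneous fixed point of $C_a$ is a finite fixed point of $C_a$ that is not a root of $p_a$; equivalently, the extraneous fixed points are the solutions of $22z^6-23(a+1)z^4+(5a^2+16a+5)z^2-a(a+1)=0$. A fixed point $z_0\in\mathbb C$ is repelling if $|C_a'(z_0)|>1$. *)

theory Defs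
  imports
    "HOL-Complex_Analysis.Complex_Analysis"
    "HOL-Computational_Algebra.Computational_Algebra"
    "HOL-Computational_Algebra.Field_as_Ring"
begin

text \<open>
  Rational maps are elements of the field of fractions of the complex polynomials.
  A pointwise formula over the complex numbers would not do: with the convention
  \<open>x / 0 = 0\<close>, every critical point of \<open>p\<close> would become a fixed point of Chebyshev's
  method, whereas a critical point can be a pole of the rational map.
\<close>

type_synonym ratmap = "complex poly fract"

text \<open>
  Numerator and denominator are the coprime ones, so the zeros of the denominator are
  exactly the poles; the value of \<open>ratmap_eval\<close> at a pole carries no meaning.
\<close>

definition ratmap_num :: "ratmap \<Rightarrow> complex poly" where
  "ratmap_num R = fst (quot_of_fract R)"

definition ratmap_denom :: "ratmap \<Rightarrow> complex poly" where
  "ratmap_denom R = snd (quot_of_fract R)"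

definition ratmap_eval :: "ratmap \<Rightarrow> complex \<Rightarrow> complex" where
  "ratmap_eval R z = poly (ratmap_num R) z / poly (ratmap_denom R) z"

definition finite_fixed_points :: "ratmap \<Rightarrow> complex set" where
  "finite_fixed_points R = {z. poly (ratmap_denom R) z \<noteq> 0 \<and> ratmap_eval R z = z}"

definition repelling_fixed_point :: "ratmap \<Rightarrow> complex \<Rightarrow> bool" where
  "repelling_fixed_point R z \<longleftrightarrow>
     z \<in> finite_fixed_points R \<and> cmod (deriv (ratmap_eval R) z) > 1"

definition chebyshev_L :: "complex poly \<Rightarrow> ratmap" where
  "chebyshev_L p =
     to_fract p * to_fract (pderiv (pderiv p)) / (to_fract (pderiv p))\<^sup>2"

definition chebyshev_method :: "complex poly \<Rightarrow> ratmap" where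
  "chebyshev_method p =
     to_fract [:0, 1:] - (1 + 1 / 2 * chebyshev_L p) * (to_fract p / to_fract (pderiv p))"

definition extraneous_fixed_points :: "complex poly \<Rightarrow> complex set" where
  "extraneous_fixed_points p =
     {z \<in> finite_fixed_points (chebyshev_method p). poly p z \<noteq> 0}"

definition quartic :: "complex \<Rightarrow> complex poly" where
  "quartic a = [:-1, 0, 1:] * [:-a, 0, 1:]"

end

theory Submission
  imports Defs
begin

text \<open>
  Away from the roots of $p$, a fixed point of Chebyshev's method is a zero of
  $2 p'^2 + p p''$, provided it is no pole; for $p_a$ the poles are exactly the zeros of $p_a'$.
  This expression is even in $z$, hence a cubic in $w = z^2$, and it changes sign between
  $0$, $a$, $(a+1)/2$ and $1$, so its three roots are real and lie in $(0,1)$.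
  At such a point the multiplier is $6 - 2 p' p''' / p''^2 =
  6 - 24 w (2 w - s) / (6 w - s)^2$ with $s = a + 1$. It exceeds $1$ for every real $w$ because
  the quadratic form $5 (6 w - s)^2 - 24 w (2 w - s)$ is positive definite.
\<close>

section \<open>Values and poles of fractions of polynomials\<close>

lemma ratmap_cross:
  fixes N D :: "complex poly"
  assumes "D \<noteq> 0"
  shows "N * ratmap_denom (to_fract N / to_fract D) = ratmap_num (to_fract N / to_fract D) * D"
proof -
  let ?R = "to_fract N / to_fract D"
  have nz: "ratmap_denom ?R \<noteq> 0"
    unfolding ratmap_denom_def by (rule snd_quot_of_fract_nonzero)
  have "?R = to_fract (ratmap_num ?R) / to_fract (ratmap_denom ?R)"
    unfolding ratmap_denom_def ratmap_num_def
    by (metis Fract_conv_to_fract fract_collapse(1) Fract_quot_of_fract prod.collapse)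
  \<comment> \<open>An identity of polynomials, unlike one of fractions, can be evaluated at every
    point, zeros of \<open>D\<close> included.\<close>
  then have "to_fract (N * ratmap_denom ?R) = to_fract (ratmap_num ?R * D)"
    using assms nz by (simp add: frac_eq_eq)
  then show ?thesis
    by (simp only: to_fract_eq_iff)
qed

lemma ratmap_no_common_zero:
  "poly (ratmap_num R) z \<noteq> 0 \<or> poly (ratmap_denom R) z \<noteq> 0"
proof -
  have "coprime (ratmap_num R) (ratmap_denom R)"
    unfolding ratmap_denom_def ratmap_num_def by (rule coprime_quot_of_fract)
  then show ?thesis
    using coprime_poly_0 by blast
qed

text \<open>By cross-multiplication, a zero of the reduced denominator at \<open>z\<close> would be
  a zero of the reduced numerator too, against coprimality.\<close>

lemma ratmap_eval_divide:
  fixes N D :: "complex poly"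
  assumes "poly D z \<noteq> 0"
  shows "poly (ratmap_denom (to_fract N / to_fract D)) z \<noteq> 0"
    and "ratmap_eval (to_fract N / to_fract D) z = poly N z / poly D z"
proof -
  let ?R = "to_fract N / to_fract D"
  have "D \<noteq> 0"
    using assms by auto
  then have eq: "poly N z * poly (ratmap_denom ?R) z = poly (ratmap_num ?R) z * poly D z"
    by (metis ratmap_cross poly_mult)
  show nz: "poly (ratmap_denom ?R) z \<noteq> 0"
    using eq assms ratmap_no_common_zero[of ?R z] by auto
  show "ratmap_eval ?R z = poly N z / poly D z"
    using eq assms nz by (simp add: ratmap_eval_def field_simps)
qed

text \<open>Detects a pole from any representation, reduced or not, whose numerator survives at
  \<open>z\<close>.\<close>

lemma ratmap_denom_eq_0:
  fixes N D :: "complex poly"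
  assumes "D \<noteq> 0" "poly D z = 0" "poly N z \<noteq> 0"
  shows "poly (ratmap_denom (to_fract N / to_fract D)) z = 0"
  using ratmap_cross[OF assms(1), of N] assms(2,3)
  by (metis mult_eq_0_iff poly_mult)

section \<open>Chebyshev's method of a general polynomial\<close>

lemma chebyshev_method_eq_divide:
  fixes p :: "complex poly"
  assumes "pderiv p \<noteq> 0"
  shows "chebyshev_method p =
    to_fract ([:0, 2:] * pderiv p ^ 3 - (2 * (pderiv p)\<^sup>2 + p * pderiv (pderiv p)) * p)
      / to_fract (2 * pderiv p ^ 3)"
proof -
  define u v w x where "u = to_fract p" and "v = to_fract (pderiv p)"
    and "w = to_fract (pderiv (pderiv p))" and "x = to_fract [:0, 1 :: complex:]"
  have v: "v \<noteq> 0"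
    using assms by (simp add: v_def)
  have two: "to_fract (2 :: complex poly) = 2"
    by (metis one_add_one to_fract_1 to_fract_add)
  have p2: "to_fract ((pderiv p)\<^sup>2) = v\<^sup>2" and p3: "to_fract (pderiv p ^ 3) = v ^ 3"
    by (simp_all add: v_def power2_eq_square power3_eq_cube)
  have "[:0, 2:] = 2 * [:0, 1 :: complex:]"
    by (simp add: numeral_poly)
  then have x2: "to_fract [:0, 2 :: complex:] = 2 * x"
    by (simp only: to_fract_mult two x_def)
  have "(2 :: ratmap) \<noteq> 0"
    by (metis two to_fract_eq_0_iff zero_neq_numeral)
  then show ?thesis
    using v unfolding chebyshev_method_def chebyshev_L_def to_fract_mult to_fract_diff to_fract_add
      two p2 p3 x2 u_def[symmetric] v_def[symmetric] w_def[symmetric] x_def[symmetric]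
    by (simp add: field_simps power2_eq_square power3_eq_cube)
qed

lemma chebyshev_method_eval:
  fixes p :: "complex poly"
  assumes "poly (pderiv p) z \<noteq> 0"
  shows "poly (ratmap_denom (chebyshev_method p)) z \<noteq> 0"
    and "ratmap_eval (chebyshev_method p) z =
      z - (1 + poly p z * poly (pderiv (pderiv p)) z / (2 * (poly (pderiv p) z)\<^sup>2))
            * (poly p z / poly (pderiv p) z)"
proof -
  have nz: "pderiv p \<noteq> 0"
    using assms by auto
  have D: "poly (2 * pderiv p ^ 3) z \<noteq> 0"
    using assms by simp
  show "poly (ratmap_denom (chebyshev_method p)) z \<noteq> 0"
    unfolding chebyshev_method_eq_divide[OF nz] by (rule ratmap_eval_divide(1)[OF D])
  show "ratmap_eval (chebyshev_method p) z =
      z - (1 + poly p z * poly (pderiv (pderiv p)) z / (2 * (poly (pderiv p) z)\<^sup>2))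
            * (poly p z / poly (pderiv p) z)"
    unfolding chebyshev_method_eq_divide[OF nz] ratmap_eval_divide(2)[OF D]
    using assms by (simp add: field_simps power2_eq_square power3_eq_cube)
qed

text \<open>Over the denominator 2 p'^3, the numerator shrinks to -p^2 p'' where p' vanishes, and
  the hypotheses keep this nonzero.\<close>

lemma chebyshev_method_pole:
  fixes p :: "complex poly"
  assumes "poly (pderiv p) z = 0" "poly p z \<noteq> 0" "poly (pderiv (pderiv p)) z \<noteq> 0"
  shows "poly (ratmap_denom (chebyshev_method p)) z = 0"
proof -
  have nz: "pderiv p \<noteq> 0"
    using assms(3) by auto
  then show ?thesis
    unfolding chebyshev_method_eq_divide[OF nz]
    using assms by (intro ratmap_denom_eq_0) auto
qed

text \<open>The method subtracts (1 + L_p/2) p/p' from z; here p/p' is nonzero, so the first factor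
  must vanish.\<close>

lemma extraneous_fixed_point_noncritical_iff:
  fixes p :: "complex poly"
  assumes "poly p z \<noteq> 0" "poly (pderiv p) z \<noteq> 0"
  shows "z \<in> extraneous_fixed_points p \<longleftrightarrow>
    2 * (poly (pderiv p) z)\<^sup>2 + poly p z * poly (pderiv (pderiv p)) z = 0"
proof -
  define u v w where "u = poly p z" and "v = poly (pderiv p) z" and "w = poly (pderiv (pderiv p)) z"
  have "u \<noteq> 0" "v \<noteq> 0"
    using assms by (simp_all add: u_def v_def)
  moreover have "z \<in> extraneous_fixed_points p \<longleftrightarrow> z - (1 + u * w / (2 * v\<^sup>2)) * (u / v) = z"
    using assms chebyshev_method_eval[OF assms(2)]
    by (simp add: extraneous_fixed_points_def finite_fixed_points_def u_def v_def w_def)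
  ultimately have "z \<in> extraneous_fixed_points p \<longleftrightarrow> 1 + u * w / (2 * v\<^sup>2) = 0"
    by simp
  also have "\<dots> \<longleftrightarrow> 2 * v\<^sup>2 + u * w = 0"
    using \<open>v \<noteq> 0\<close> by (simp add: field_simps)
  finally show ?thesis
    by (simp only: u_def v_def w_def)
qed

text \<open>
  At an extraneous fixed point $1 + L_p/2$ vanishes, which eliminates $p$ itself from the multiplier.
\<close>

lemma chebyshev_method_multiplier:
  fixes p :: "complex poly"
  assumes "poly (pderiv p) z \<noteq> 0"
    and fp: "2 * (poly (pderiv p) z)\<^sup>2 + poly p z * poly (pderiv (pderiv p)) z = 0"
  shows "deriv (ratmap_eval (chebyshev_method p)) z =
    6 - 2 * poly (pderiv p) z * poly (pderiv (pderiv (pderiv p))) z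
          / (poly (pderiv (pderiv p)) z)\<^sup>2"
proof -
  define P P1 P2 P3 where "P = poly p" and "P1 = poly (pderiv p)"
    and "P2 = poly (pderiv (pderiv p))" and "P3 = poly (pderiv (pderiv (pderiv p)))"
  have [derivative_intros]: "(P has_field_derivative P1 x) (at x)"
    "(P1 has_field_derivative P2 x) (at x)" "(P2 has_field_derivative P3 x) (at x)" for x
    by (simp_all add: P_def P1_def P2_def P3_def poly_DERIV)
  have nz1: "P1 z \<noteq> 0" and fp': "2 * (P1 z)\<^sup>2 + P z * P2 z = 0"
    using assms by (simp_all add: P1_def P_def P2_def)
  then have nz2: "P2 z \<noteq> 0"
    by auto
  \<comment> \<open>Solving the fixed point equation for p leaves only derivatives of p in the
    multiplier.\<close>
  have Pz: "P z = - 2 * (P1 z)\<^sup>2 / P2 z"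
    using fp' nz2 by (simp add: field_simps add_eq_0_iff)
  define h where "h x = 1 + P x * P2 x / (2 * (P1 x)\<^sup>2)" for x
  define H where "H = ((P1 z * P2 z + P z * P3 z) * P1 z - 2 * P z * (P2 z)\<^sup>2) / (2 * P1 z ^ 3)"
  have hz: "h z = 0"
    using nz1 nz2 by (simp add: h_def Pz)
  have dh: "(h has_field_derivative H) (at z)"
    unfolding h_def H_def using nz1
    by (auto intro!: derivative_eq_intros simp: field_simps power2_eq_square power3_eq_cube)
  have dg: "((\<lambda>x. P x / P1 x) has_field_derivative
      (P1 z * P1 z - P z * P2 z) / (P1 z * P1 z)) (at z)"
    using nz1 by (auto intro!: derivative_eq_intros)
  \<comment> \<open>As \<open>h z = 0\<close>, the product rule leaves only this term, and the
    derivative from \<open>dg\<close> drops out; the multiplier is 1 minus it.\<close>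
  have "H * (P z / P1 z) = - 5 + 2 * P1 z * P3 z / (P2 z)\<^sup>2"
    unfolding H_def Pz using nz1 nz2 by (simp add: field_simps power2_eq_square power3_eq_cube)
  then have "((\<lambda>x. x - h x * (P x / P1 x)) has_field_derivative
      6 - 2 * P1 z * P3 z / (P2 z)\<^sup>2) (at z)"
    using DERIV_diff[OF DERIV_ident DERIV_mult[OF dh dg]] by (simp add: hz)
  \<comment> \<open>The pointwise formula is valid off the critical points only; these form an open
    neighbourhood of \<open>z\<close>, which suffices for the derivative.\<close>
  moreover have "open {x. P1 x \<noteq> 0}"
    unfolding P1_def by (intro open_Collect_neq continuous_intros)
  ultimately have "(ratmap_eval (chebyshev_method p) has_field_derivative
      6 - 2 * P1 z * P3 z / (P2 z)\<^sup>2) (at z)"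
    by (rule has_field_derivative_transform_within_open)
      (use nz1 chebyshev_method_eval(2) in \<open>auto simp: h_def P_def P1_def P2_def\<close>)
  then show ?thesis
    by (simp add: DERIV_imp_deriv P1_def P2_def P3_def)
qed

section \<open>Location of the extraneous fixed points of the quartic\<close>

lemma poly_pderivs_quartic:
  "poly (quartic a) z = (z\<^sup>2 - 1) * (z\<^sup>2 - a)"
  "poly (pderiv (quartic a)) z = 2 * z * (2 * z\<^sup>2 - (a + 1))"
  "poly (pderiv (pderiv (quartic a))) z = 2 * (6 * z\<^sup>2 - (a + 1))"
  "poly (pderiv (pderiv (pderiv (quartic a)))) z = 24 * z"
  by (simp_all add: quartic_def pderiv_pCons algebra_simps power2_eq_square)

text \<open>Half of 2 p'^2 + p p'' in the variable w = z^2. Polymorphic, since signs are studied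
  over the reals and roots counted over the complex numbers.\<close>

definition extraneous_cubic :: "'a::comm_ring_1 \<Rightarrow> 'a poly" where
  "extraneous_cubic a = [:- a * (a + 1), 5 * a\<^sup>2 + 16 * a + 5, - 23 * (a + 1), 22:]"

lemma poly_extraneous_cubic_of_real:
  "poly (extraneous_cubic (complex_of_real a)) (of_real w) = of_real (poly (extraneous_cubic a) w)"
  by (simp add: extraneous_cubic_def)

text \<open>Critical points satisfy z = 0 or z^2 = (a+1)/2. There p'' is -2(a+1) or 4(a+1), nonzero
  as a > 0, so they are poles or roots of p and never extraneous fixed points.\<close>

lemma extraneous_fixed_point_quartic:
  assumes "0 < a"
    and z: "z \<in> extraneous_fixed_points (quartic (complex_of_real a))"
  shows "poly (pderiv (quartic (complex_of_real a))) z \<noteq> 0"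
    and "poly (extraneous_cubic (complex_of_real a)) (z\<^sup>2) = 0"
proof -
  let ?p = "quartic (complex_of_real a)"
  have nz: "poly ?p z \<noteq> 0" and denom: "poly (ratmap_denom (chebyshev_method ?p)) z \<noteq> 0"
    using z by (auto simp: extraneous_fixed_points_def finite_fixed_points_def)
  have s: "complex_of_real a + 1 \<noteq> 0"
    using assms(1) by (metis of_real_1 of_real_add of_real_eq_0_iff add_pos_pos less_irrefl zero_less_one)
  show crit: "poly (pderiv ?p) z \<noteq> 0"
  proof
    assume *: "poly (pderiv ?p) z = 0"
    then have "z = 0 \<or> 2 * z\<^sup>2 = complex_of_real a + 1"
      by (auto simp: poly_pderivs_quartic)
    then have "poly (pderiv (pderiv ?p)) z = - 2 * (complex_of_real a + 1)
        \<or> poly (pderiv (pderiv ?p)) z = 4 * (complex_of_real a + 1)"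
    proof
      assume "2 * z\<^sup>2 = complex_of_real a + 1"
      moreover have "6 * z\<^sup>2 = 3 * (2 * z\<^sup>2)"
        by simp
      ultimately have "6 * z\<^sup>2 = 3 * (complex_of_real a + 1)"
        by simp
      then show ?thesis
        by (simp add: poly_pderivs_quartic)
    qed (simp add: poly_pderivs_quartic)
    then have "poly (pderiv (pderiv ?p)) z \<noteq> 0"
      using s by (auto simp del: distrib_left_numeral)
    then show False
      using chebyshev_method_pole[OF * nz] denom by simp
  qed
  have "2 * (poly (pderiv ?p) z)\<^sup>2 + poly ?p z * poly (pderiv (pderiv ?p)) z
      = 2 * poly (extraneous_cubic (complex_of_real a)) (z\<^sup>2)"
    by (simp add: poly_pderivs_quartic extraneous_cubic_def algebra_simps power2_eq_square)
  then show "poly (extraneous_cubic (complex_of_real a)) (z\<^sup>2) = 0"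
    using z extraneous_fixed_point_noncritical_iff[OF nz crit] by simp
qed

text \<open>The signs come from p'^2 + p p''/2: at the roots of p, w = a and w = 1, only the square
  survives; at w = 0 and w = (a+1)/2, where p' vanishes, only p p''/2 does, and it is
  negative.\<close>

lemma extraneous_cubic_roots:
  assumes "0 < a" "a < 1" and w: "poly (extraneous_cubic (complex_of_real a)) w = 0"
  shows "w \<in> complex_of_real ` {0<..<1}"
proof -
  let ?q = "extraneous_cubic a" and ?qc = "extraneous_cubic (complex_of_real a)"
  have q0: "poly ?q 0 < 0"
    using assms by (simp add: extraneous_cubic_def)
  have "poly ?q a = 4 * a * (1 - a)\<^sup>2"
    by (simp add: extraneous_cubic_def algebra_simps power2_eq_square)
  then have qa: "poly ?q a > 0"
    using assms by simp
  have "poly ?q ((a + 1) / 2) = - (a + 1) * (1 - a)\<^sup>2 / 2"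
    by (simp add: extraneous_cubic_def field_simps power2_eq_square)
  then have qs: "poly ?q ((a + 1) / 2) < 0"
    using assms by (simp only: divide_less_0_iff mult_less_0_iff) simp
  have "poly ?q 1 = 4 * (1 - a)\<^sup>2"
    by (simp add: extraneous_cubic_def algebra_simps power2_eq_square)
  then have q1: "poly ?q 1 > 0"
    using assms by simp
  obtain r1 r2 r3 where r: "0 < r1" "r1 < a" "a < r2" "r2 < (a + 1) / 2" "(a + 1) / 2 < r3" "r3 < 1"
    and roots: "poly ?q r1 = 0" "poly ?q r2 = 0" "poly ?q r3 = 0"
    using poly_IVT_pos[OF _ q0 qa] poly_IVT_neg[OF _ qa qs] poly_IVT_pos[OF _ qs q1] assms by auto
  let ?A = "complex_of_real ` {r1, r2, r3}"
  have deg: "degree ?qc = 3" and nz: "?qc \<noteq> 0"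
    by (simp_all add: extraneous_cubic_def)
  have "card ?A = 3"
    using r by (subst card_image) (auto simp: inj_on_def)
  moreover have "card {x. poly ?qc x = 0} \<le> 3"
    using card_poly_roots_bound[OF nz] deg by simp
  moreover have "?A \<subseteq> {x. poly ?qc x = 0}"
    using roots by (auto simp: poly_extraneous_cubic_of_real)
  \<comment> \<open>Three distinct real zeros exhaust a cubic, so no nonreal one is left.\<close>
  ultimately have "?A = {x. poly ?qc x = 0}"
    using poly_roots_finite[OF nz] by (intro card_seteq) auto
  then have "w \<in> ?A"
    using w by blast
  also have "?A \<subseteq> complex_of_real ` {0<..<1}"
    using r assms by (intro image_mono) auto
  finally show ?thesis .
qed

text \<open>A positive real has just two complex square roots, both real.\<close>

lemma square_in_unit_interval:
  assumes "z\<^sup>2 \<in> complex_of_real ` {0<..<1}"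
  shows "z \<in> complex_of_real ` {-1<..<1}"
proof -
  obtain w where w: "0 < w" "w < 1" "z\<^sup>2 = complex_of_real w"
    using assms by auto
  then have "z\<^sup>2 = (complex_of_real (sqrt w))\<^sup>2"
    by (metis less_imp_le of_real_power real_sqrt_pow2)
  then have "z = complex_of_real (sqrt w) \<or> z = complex_of_real (- sqrt w)"
    by (simp add: power2_eq_iff)
  moreover have "sqrt w \<in> {-1<..<1}" "- sqrt w \<in> {-1<..<1}"
    using w by (simp_all add: less_trans[OF _ real_sqrt_gt_zero])
  ultimately show ?thesis
    by (metis imageI)
qed

section \<open>The multiplier exceeds 1\<close>

lemma extraneous_multiplier_gt_1:
  fixes w s :: real
  assumes "6 * w \<noteq> s"
  shows "6 - 24 * w * (2 * w - s) / (6 * w - s)\<^sup>2 > 1"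
proof -
  \<comment> \<open>Completing the square in \<open>w\<close>: the left side expands to 132 w^2 - 36
    w s + 5 s^2.\<close>
  have "5 * (6 * w - s)\<^sup>2 - 24 * w * (2 * w - s) = 132 * (w - 3 / 22 * s)\<^sup>2 + 28 / 11 * s\<^sup>2"
    by (simp add: field_simps power2_eq_square)
  moreover have "132 * (w - 3 / 22 * s)\<^sup>2 + 28 / 11 * s\<^sup>2 > 0"
  proof (cases "s = 0")
    \<comment> \<open>The second square vanishes, but \<open>6 * w \<noteq> s\<close> keeps the
      first positive.\<close>
    case True
    then show ?thesis using assms by simp
  next
    case False
    then show ?thesis by (intro add_nonneg_pos) simp_all
  qed
  moreover have "(6 * w - s)\<^sup>2 > 0"
    using assms by simp
  ultimately show ?thesis
    by (simp add: field_simps)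
qed

theorem lemma3p5:
  fixes a :: real
  assumes "0 < a" and "a < 1"
  shows "extraneous_fixed_points (quartic (complex_of_real a))
           \<subseteq> complex_of_real ` {-1<..<1} \<and>
         (\<forall>z \<in> extraneous_fixed_points (quartic (complex_of_real a)).
            repelling_fixed_point (chebyshev_method (quartic (complex_of_real a))) z)"
proof (intro conjI subsetI ballI)
  let ?p = "quartic (complex_of_real a)"
  fix z
  assume z: "z \<in> extraneous_fixed_points ?p"
  note crit = extraneous_fixed_point_quartic(1)[OF assms(1) z]
  have root: "z\<^sup>2 \<in> complex_of_real ` {0<..<1}"
    using extraneous_fixed_point_quartic(2)[OF assms(1) z] by (rule extraneous_cubic_roots[OF assms])
  then show "z \<in> complex_of_real ` {-1<..<1}"
    by (rule square_in_unit_interval)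
  have fixpt: "z \<in> finite_fixed_points (chebyshev_method ?p)" and nz: "poly ?p z \<noteq> 0"
    using z by (simp_all add: extraneous_fixed_points_def)
  have fp: "2 * (poly (pderiv ?p) z)\<^sup>2 + poly ?p z * poly (pderiv (pderiv ?p)) z = 0"
    using z extraneous_fixed_point_noncritical_iff[OF nz crit] by simp
  \<comment> \<open>If p'' vanished, \<open>fp\<close> would force p' = 0.\<close>
  then have inflection: "poly (pderiv (pderiv ?p)) z \<noteq> 0"
    using crit by auto
  obtain w where w: "z\<^sup>2 = complex_of_real w"
    using root by auto
  define m where "m = 6 - 24 * w * (2 * w - (a + 1)) / (6 * w - (a + 1))\<^sup>2"
  have p2: "poly (pderiv (pderiv ?p)) z = complex_of_real (2 * (6 * w - (a + 1)))"
    by (simp add: poly_pderivs_quartic w)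
  then have ne: "6 * w \<noteq> a + 1"
    using inflection by (metis diff_self mult_zero_right of_real_0)
  \<comment> \<open>Both p' and p''' are odd in z; their product is even, hence a real expression in
    \<open>w\<close>.\<close>
  have "poly (pderiv ?p) z * poly (pderiv (pderiv (pderiv ?p))) z
      = 48 * z\<^sup>2 * (2 * z\<^sup>2 - (complex_of_real a + 1))"
    by (simp add: poly_pderivs_quartic algebra_simps power2_eq_square)
  then have p13: "poly (pderiv ?p) z * poly (pderiv (pderiv (pderiv ?p))) z
      = complex_of_real (48 * w * (2 * w - (a + 1)))"
    by (simp add: w)
  have "deriv (ratmap_eval (chebyshev_method ?p)) z
      = 6 - 2 * poly (pderiv ?p) z * poly (pderiv (pderiv (pderiv ?p))) z
          / (poly (pderiv (pderiv ?p)) z)\<^sup>2"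
    by (rule chebyshev_method_multiplier[OF crit fp])
  also have "\<dots> = 6 - 2 * complex_of_real (48 * w * (2 * w - (a + 1)))
      / (complex_of_real (2 * (6 * w - (a + 1))))\<^sup>2"
    by (simp only: p2 mult.assoc p13[unfolded mult.assoc])
  also have "\<dots> = complex_of_real (6 - 2 * (48 * w * (2 * w - (a + 1))) / (2 * (6 * w - (a + 1)))\<^sup>2)"
    by simp
  \<comment> \<open>The factor 2 of p'' is squared in the denominator, so 96/4 gives the 24 of
    \<open>m\<close>.\<close>
  also have "6 - 2 * (48 * w * (2 * w - (a + 1))) / (2 * (6 * w - (a + 1)))\<^sup>2 = m"
    using ne by (simp only: m_def power_mult_distrib) (simp add: divide_simps)
  finally have "deriv (ratmap_eval (chebyshev_method ?p)) z = complex_of_real m" .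
  moreover have "m > 1"
    unfolding m_def by (rule extraneous_multiplier_gt_1[OF ne])
  ultimately show "repelling_fixed_point (chebyshev_method ?p) z"
    using fixpt by (simp add: repelling_fixed_point_def)
qed

end
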